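(* Let $X_1, \dotsc, X_p$ and $y$ be random variables (on a common probability space), each taking values in a discrete space. Then $$\sum_{i=1}^p I(X_i ; y) \ \leq \ H(y) + \sum_{i=1}^p I(X_i ; X_{-i}),$$ where $X_{-i} = (X_1, \dotsc, X_{i-1}, X_{i+1}, \dotsc, X_p)$.
   Context: For discrete random variables $u$ (with range $\mathcal{U}$) and $v$ (with range $\mathcal{V}$), with joint probability mass function $p(u,v)$ and marginal probability mass function $p(u)$ of $u$ (and likewise for $v$), the entropy and conditional entropy are $$H(u) = \sum_{a \in \mathcal{U}} p(a)\log\frac{1}{p(a)}, \qquad H(v \mid u) = \sum_{a \in \mathcal{U},\, b \in \mathcal{V}} p(a,b)\log\frac{p(a)}{p(a,b)},$$ with terms of zero probability counted as $0$. The mutual information is $$I(u;v) = H(u) - H(u \mid v) = H(v) - H(v \mid u).$$ A tuple of discrete random variables, such as $X_{-i}$, is regarded as a single discrete random variable. The entropies involved are understood to be finite, so that these differences are well-defined. *)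

theory Defs
  imports "HOL-Probability.Probability"
begin

(* The entropies of HOL-Probability are those of the discrete setting when the reference measures
   are counting measures; the lemmas below recover the usual sums, and the identities
   I(X;Y) = H(X) - H(X|Y) = H(Y) - H(Y|X), for variables with values in countable sets. *)

lemma integral_count_space_eq_infsum:
  fixes f :: "'a \<Rightarrow> real"
  assumes "integrable (count_space A) f"
  shows "(\<integral>x. f x \<partial>count_space A) = (\<Sum>\<^sub>\<infinity>x\<in>A. f x)"
  using assms infsetsum_infsum[of f A]
  by (simp add: Infinite_Set_Sum.abs_summable_on_def infsetsum_def)

context information_space
begin

lemma distributed_count_space:
  assumes "countable S" and X: "X \<in> measurable M (count_space S)"
  shows "distributed M (count_space S) X (\<lambda>x. ennreal (prob (X -` {x} \<inter> space M)))"
proof -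
  have "distr M (count_space S) X
      = density (count_space S) (\<lambda>x. ennreal (prob (X -` {x} \<inter> space M)))"
  proof (rule measure_eqI_countable[where A = S])
    fix a assume a: "a \<in> S"
    then have "emeasure (distr M (count_space S) X) {a} = ennreal (prob (X -` {a} \<inter> space M))"
      using X by (subst emeasure_distr) (auto simp: emeasure_eq_measure)
    also have "\<dots> = emeasure (density (count_space S)
        (\<lambda>x. ennreal (prob (X -` {x} \<inter> space M)))) {a}"
      using a by (subst emeasure_density)
        (auto simp: nn_integral_indicator_singleton nn_integral_cmult_indicator)
    finally show "emeasure (distr M (count_space S) X) {a} = emeasure (density (count_space S)
        (\<lambda>x. ennreal (prob (X -` {x} \<inter> space M)))) {a}" .
  qed (use assms in auto)
  then show ?thesis
    using X by (simp add: distributed_def)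
qed

lemma entropy_count_space:
  assumes "countable S"
    and fX: "finite_entropy (count_space S) X (\<lambda>x. prob (X -` {x} \<inter> space M))"
  shows "entropy b (count_space S) X
    = (\<Sum>\<^sub>\<infinity>x\<in>S. prob (X -` {x} \<inter> space M) * log b (1 / prob (X -` {x} \<inter> space M)))"
proof -
  let ?p = "\<lambda>x. prob (X -` {x} \<inter> space M)"
  have eq: "?p x * log b (1 / ?p x) = - (?p x * log b (?p x))" for x
    by (cases "?p x = 0") (simp_all add: log_divide measure_nonneg less_le)
  have "entropy b (count_space S) X = - (\<integral>x. ?p x * log b (?p x) \<partial>count_space S)"
    using finite_entropy_distributed[OF fX] by (intro entropy_distr) auto
  then show ?thesis
    unfolding eq
    by (simp add: integral_count_space_eq_infsum[OF finite_entropy_integrable[OF fX]] infsum_uminus)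
qed

lemma finite_entropy_Pair_count_space:
  assumes S: "countable S" and T: "countable T"
    and fX: "finite_entropy (count_space S) X (\<lambda>x. prob (X -` {x} \<inter> space M))"
    and fY: "finite_entropy (count_space T) Y (\<lambda>y. prob (Y -` {y} \<inter> space M))"
  shows "finite_entropy (count_space (S \<times> T)) (\<lambda>\<omega>. (X \<omega>, Y \<omega>))
    (\<lambda>z. prob ((\<lambda>\<omega>. (X \<omega>, Y \<omega>)) -` {z} \<inter> space M))"
proof -
  let ?px = "\<lambda>x. prob (X -` {x} \<inter> space M)"
  let ?py = "\<lambda>y. prob (Y -` {y} \<inter> space M)"
  let ?p = "\<lambda>z. prob ((\<lambda>\<omega>. (X \<omega>, Y \<omega>)) -` {z} \<inter> space M)"
  let ?C = "count_space (S \<times> T)"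
  have dX: "distributed M (count_space S) X ?px" and dY: "distributed M (count_space T) Y ?py"
    using fX fY by (auto dest: finite_entropy_distributed)
  then have X: "X \<in> measurable M (count_space S)" and Y: "Y \<in> measurable M (count_space T)"
    by (auto simp: distributed_def)
  have XY: "(\<lambda>\<omega>. (X \<omega>, Y \<omega>)) \<in> measurable M ?C"
    using measurable_Pair[OF X Y] by (simp add: pair_measure_countable S T)
  have d: "distributed M ?C (\<lambda>\<omega>. (X \<omega>, Y \<omega>)) ?p"
    using S T XY by (intro distributed_count_space) auto
  have ix: "integrable (count_space S) ?px"
    using distributed_integrable[OF dX, of "\<lambda>_. 1::real"] by simp
  have iy: "integrable (count_space T) ?py"
    using distributed_integrable[OF dY, of "\<lambda>_. 1::real"] by simp
  have i: "integrable ?C ?p"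
    using distributed_integrable[OF d, of "\<lambda>_. 1::real"] by simp
  have ixy: "integrable ?C (\<lambda>z. ?px (fst z) * ?py (snd z))"
    using abs_summable_on_product[where f = "?px" and g = "?py" and A = S and B = T] ix iy S T
    by (simp add: Infinite_Set_Sum.abs_summable_on_def case_prod_beta')
  have lx: "integrable ?C (\<lambda>z. ?p z * log b (?px (fst z)))"
    by (rule finite_entropy_integrable_transform[OF fX d]) auto
  have ly: "integrable ?C (\<lambda>z. ?p z * log b (?py (snd z)))"
    by (rule finite_entropy_integrable_transform[OF fY d]) auto
  have bound: "norm (?p z * log b (?p z)) \<le> norm ((?px (fst z) * ?py (snd z) - ?p z) / ln b
      - ?p z * log b (?px (fst z)) - ?p z * log b (?py (snd z)))" for z
  proof -
    obtain x y where z: "z = (x, y)" by (cases z)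
    have lnb: "ln b > 0" using b_gt_1 by simp
    show ?thesis
    proof (cases "?p z = 0")
      case False
      then have p0: "?p z > 0" by (simp add: less_le)
      have mX: "X -` {x} \<inter> space M \<in> events" if "x \<in> S"
        using X that by (auto intro: measurable_sets)
      have mY: "Y -` {y} \<inter> space M \<in> events" if "y \<in> T"
        using Y that by (auto intro: measurable_sets)
      have "(\<lambda>\<omega>. (X \<omega>, Y \<omega>)) -` {z} \<inter> space M \<noteq> {}"
        using p0 by (intro notI) (metis less_irrefl measure_empty)
      then have "x \<in> S" "y \<in> T"
        using X Y z by (auto simp: measurable_def Pi_def)
      then have "?p z \<le> ?px x" "?p z \<le> ?py y"
        using mX mY z by (auto intro!: finite_measure_mono)
      then have px: "?px x > 0" and py: "?py y > 0" using p0 by linarith+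
      have "ln (?px x * ?py y / ?p z) \<le> ?px x * ?py y / ?p z - 1"
        using px py p0 by (intro ln_le_minus_one) simp
      then have "ln (?px x) + ln (?py y) - ln (?p z) \<le> ?px x * ?py y / ?p z - 1"
        using px py p0 by (simp add: ln_div ln_mult)
      then have "?p z * (ln (?px x) + ln (?py y) - ln (?p z)) \<le> ?p z * (?px x * ?py y / ?p z - 1)"
        using p0 by (intro mult_left_mono) auto
      also have "\<dots> = ?px x * ?py y - ?p z"
        using p0 by (simp add: field_simps)
      finally have "- (?p z * ln (?p z)) / ln b \<le>
          (?px x * ?py y - ?p z - ?p z * ln (?px x) - ?p z * ln (?py y)) / ln b"
        using lnb by (intro divide_right_mono) (auto simp: algebra_simps)
      then have *: "- (?p z * log b (?p z)) \<le> (?px x * ?py y - ?p z) / ln b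
          - ?p z * log b (?px x) - ?p z * log b (?py y)"
        by (simp add: log_def diff_divide_distrib)
      have "ln (?p z) \<le> 0" using p0 by simp
      then have "?p z * log b (?p z) \<le> 0"
        using p0 lnb by (simp add: log_def mult_nonneg_nonpos divide_nonpos_pos)
      then show ?thesis using * z by simp
    qed simp
  qed
  have "integrable ?C (\<lambda>z. ?p z * log b (?p z))"
    by (rule Bochner_Integration.integrable_bound[where f = "\<lambda>z. (?px (fst z) * ?py (snd z) - ?p z) / ln b
      - ?p z * log b (?px (fst z)) - ?p z * log b (?py (snd z))"])
      (use bound i ixy lx ly in auto)
  with d show ?thesis by (simp add: finite_entropy_def)
qed

lemma
  assumes S: "countable S" and T: "countable T"
    and fX: "finite_entropy (count_space S) X (\<lambda>x. prob (X -` {x} \<inter> space M))"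
    and fY: "finite_entropy (count_space T) Y (\<lambda>y. prob (Y -` {y} \<inter> space M))"
  shows conditional_entropy_count_space:
      "conditional_entropy b (count_space T) (count_space S) Y X =
        (\<Sum>\<^sub>\<infinity>(x, y)\<in>S \<times> T. prob (X -` {x} \<inter> Y -` {y} \<inter> space M) *
          log b (prob (X -` {x} \<inter> space M) / prob (X -` {x} \<inter> Y -` {y} \<inter> space M)))" (is ?ce)
    and mutual_information_count_space:
      "mutual_information b (count_space S) (count_space T) X Y =
        entropy b (count_space S) X - conditional_entropy b (count_space S) (count_space T) X Y"
      (is ?mi)
    and mutual_information_count_space':
      "mutual_information b (count_space S) (count_space T) X Y =
        entropy b (count_space T) Y - conditional_entropy b (count_space T) (count_space S) Y X"
      (is ?mi')
proof -
  let ?px = "\<lambda>x. prob (X -` {x} \<inter> space M)"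
  let ?py = "\<lambda>y. prob (Y -` {y} \<inter> space M)"
  let ?pxy = "\<lambda>z. prob ((\<lambda>\<omega>. (X \<omega>, Y \<omega>)) -` {z} \<inter> space M)"
  let ?pyx = "\<lambda>z. prob ((\<lambda>\<omega>. (Y \<omega>, X \<omega>)) -` {z} \<inter> space M)"
  note [simp] = pair_measure_countable[OF S T] pair_measure_countable[OF T S]
  have sS: "sigma_finite_measure (count_space S)" and sT: "sigma_finite_measure (count_space T)"
    using S T by (auto intro: sigma_finite_measure_count_space_countable)
  note fXY = finite_entropy_Pair_count_space[OF S T fX fY]
  note fYX = finite_entropy_Pair_count_space[OF T S fY fX]
  note dX = finite_entropy_distributed[OF fX] and dY = finite_entropy_distributed[OF fY]
  note dXY = finite_entropy_distributed[OF fXY] and dYX = finite_entropy_distributed[OF fYX]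
  have xyX: "integrable (count_space (S \<times> T)) (\<lambda>z. ?pxy z * log b (?px (fst z)))"
    by (rule finite_entropy_integrable_transform[OF fX dXY]) auto
  have xyY: "integrable (count_space (S \<times> T)) (\<lambda>z. ?pxy z * log b (?py (snd z)))"
    by (rule finite_entropy_integrable_transform[OF fY dXY]) auto
  have yxX: "integrable (count_space (T \<times> S)) (\<lambda>z. ?pyx z * log b (?px (snd z)))"
    by (rule finite_entropy_integrable_transform[OF fX dYX]) auto
  have swap: "?pyx (y, x) = ?pxy (x, y)" for x y
    by (rule arg_cong[where f = prob]) auto
  have mi: "mutual_information b (count_space S) (count_space T) X Y =
      entropy b (count_space S) X + entropy b (count_space T) Y
        - entropy b (count_space (S \<times> T)) (\<lambda>\<omega>. (X \<omega>, Y \<omega>))"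
    using mutual_information_eq_entropy_conditional_entropy_distr
      [OF sS sT dX _ dY, of "?pxy"] dXY xyX xyY finite_entropy_integrable[OF fXY] by simp
  have cXY: "conditional_entropy b (count_space S) (count_space T) X Y =
      entropy b (count_space (S \<times> T)) (\<lambda>\<omega>. (X \<omega>, Y \<omega>)) - entropy b (count_space T) Y"
    using conditional_entropy_eq_entropy[OF sS sT dY, of X "?pxy"] dXY xyY
      finite_entropy_integrable[OF fXY] by simp
  have cYX: "conditional_entropy b (count_space T) (count_space S) Y X =
      entropy b (count_space (T \<times> S)) (\<lambda>\<omega>. (Y \<omega>, X \<omega>)) - entropy b (count_space S) X"
    using conditional_entropy_eq_entropy[OF sT sS dX, of Y "?pyx"] dYX yxX
      finite_entropy_integrable[OF fYX] by simp
  have "entropy b (count_space (T \<times> S)) (\<lambda>\<omega>. (Y \<omega>, X \<omega>))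
      = (\<Sum>\<^sub>\<infinity>z\<in>T \<times> S. ?pyx z * log b (1 / ?pyx z))"
    using S T by (intro entropy_count_space fYX) auto
  also have "\<dots> = (\<Sum>\<^sub>\<infinity>z\<in>S \<times> T. ?pxy z * log b (1 / ?pxy z))"
    by (rule infsum_reindex_bij_witness[of _ prod.swap prod.swap]) (auto simp: swap)
  also have "\<dots> = entropy b (count_space (S \<times> T)) (\<lambda>\<omega>. (X \<omega>, Y \<omega>))"
    using S T by (intro entropy_count_space[symmetric] fXY) auto
  finally show ?mi' using mi cYX by simp
  show ?mi using mi cXY by simp
  let ?q = "\<lambda>x y. prob (X -` {x} \<inter> Y -` {y} \<inter> space M)"
  have q: "?pyx (y, x) = ?q x y" for x y
    by (rule arg_cong[where f = prob]) auto
  have mX: "X -` {x} \<inter> space M \<in> events" if "x \<in> S" for x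
    using dX that by (auto simp: distributed_def intro: measurable_sets)
  have eq: "- (?q x y * log b (?q x y / ?px x)) = ?q x y * log b (?px x / ?q x y)" 
    and eq': "?q x y * log b (?q x y / ?px x) = ?q x y * log b (?q x y) - ?q x y * log b (?px x)"
    if "x \<in> S" for x y
  proof -
    have "?q x y \<le> ?px x"
      using mX[OF that] by (auto intro!: finite_measure_mono)
    then have "?q x y = 0 \<or> ?q x y > 0 \<and> ?px x > 0"
      using measure_nonneg[of M "X -` {x} \<inter> Y -` {y} \<inter> space M"] by linarith
    then show "- (?q x y * log b (?q x y / ?px x)) = ?q x y * log b (?px x / ?q x y)"
      "?q x y * log b (?q x y / ?px x) = ?q x y * log b (?q x y) - ?q x y * log b (?px x)"
      by (auto simp: log_divide algebra_simps)
  qed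
  have "integrable (count_space (T \<times> S))
      (\<lambda>z. ?pyx z * log b (?pyx z) - ?pyx z * log b (?px (snd z)))"
    using finite_entropy_integrable[OF fYX] yxX by (rule Bochner_Integration.integrable_diff)
  then have int: "integrable (count_space (T \<times> S)) (\<lambda>(y, x). ?q x y * log b (?q x y / ?px x))"
    by (rule Bochner_Integration.integrable_cong[THEN iffD1, rotated 2]) (auto simp: q eq')
  have "conditional_entropy b (count_space T) (count_space S) Y X =
      - (\<integral>(y, x). ?q x y * log b (?q x y / ?px x) \<partial>count_space (T \<times> S))"
    using conditional_entropy_generic_eq[OF sT sS dX, of Y "?pyx"] dYX by (simp add: q)
  also have "\<dots> = - (\<Sum>\<^sub>\<infinity>(y, x)\<in>T \<times> S. ?q x y * log b (?q x y / ?px x))"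
    by (simp add: integral_count_space_eq_infsum[OF int])
  also have "\<dots> = (\<Sum>\<^sub>\<infinity>(y, x)\<in>T \<times> S. - (?q x y * log b (?q x y / ?px x)))"
    by (simp add: infsum_uminus[symmetric] case_prod_beta')
  also have "\<dots> = (\<Sum>\<^sub>\<infinity>(x, y)\<in>S \<times> T. ?q x y * log b (?px x / ?q x y))"
    by (rule infsum_reindex_bij_witness[of _ prod.swap prod.swap]) (auto simp: eq)
  finally show ?ce .
qed

end

end

theory Submission
  imports Defs
begin

text \<open>
  Writing both sides through joint entropies, the claim is
  \<open>(\<Sum>i. H(X_i | X_{-i})) \<le> H(y) + (\<Sum>i. H(X_i | y))\<close>.
  It follows from the chain
  \<open>(\<Sum>i. H(X_i | X_{-i})) \<le> H(X) \<le> H(X, y) \<le> H(y) + (\<Sum>i. H(X_i | y))\<close>,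
  where the outer inequalities are the chain rule combined with the fact that conditioning
  reduces entropy.
\<close>

context information_space
begin

text \<open>
  The surprisal lives on the probability space, so it depends only on the partition that the
  random variable induces. Entropies of differently encoded tuples are thereby equal at once.
\<close>

definition surprisal :: "('a \<Rightarrow> 'c) \<Rightarrow> 'a \<Rightarrow> real" where
  "surprisal X \<omega> = - log b (prob (X -` {X \<omega>} \<inter> space M))"

definition shannon :: "('a \<Rightarrow> 'c) \<Rightarrow> real" where
  "shannon X = (\<integral>\<omega>. surprisal X \<omega> \<partial>M)"

text \<open>Finiteness of the entropy is imposed as integrability of the surprisal over
  \<open>M\<close>, not as summability over \<open>S\<close>, so that it too survives a change of
  encoding.\<close>

definition discrete_rv :: "'c set \<Rightarrow> ('a \<Rightarrow> 'c) \<Rightarrow> bool" where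
  "discrete_rv S X \<longleftrightarrow> countable S \<and> X \<in> measurable M (count_space S) \<and> integrable M (surprisal X)"

section \<open>Invariance under relabelling of values\<close>

lemma surprisal_cong:
  assumes "\<And>\<omega> \<omega>'. \<omega> \<in> space M \<Longrightarrow> \<omega>' \<in> space M \<Longrightarrow> X \<omega> = X \<omega>' \<longleftrightarrow> Y \<omega> = Y \<omega>'"
    and "\<omega> \<in> space M"
  shows "surprisal X \<omega> = surprisal Y \<omega>"
proof -
  have "X -` {X \<omega>} \<inter> space M = Y -` {Y \<omega>} \<inter> space M"
    using assms by auto
  then show ?thesis by (simp add: surprisal_def)
qed

lemma shannon_cong:
  assumes "\<And>\<omega> \<omega>'. \<omega> \<in> space M \<Longrightarrow> \<omega>' \<in> space M \<Longrightarrow> X \<omega> = X \<omega>' \<longleftrightarrow> Y \<omega> = Y \<omega>'"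
  shows "shannon X = shannon Y"
  unfolding shannon_def using surprisal_cong[OF assms] by (intro Bochner_Integration.integral_cong) auto

lemma discrete_rv_cong:
  assumes "discrete_rv S X" and "countable T" and "Y \<in> measurable M (count_space T)"
    and "\<And>\<omega> \<omega>'. \<omega> \<in> space M \<Longrightarrow> \<omega>' \<in> space M \<Longrightarrow> X \<omega> = X \<omega>' \<longleftrightarrow> Y \<omega> = Y \<omega>'"
  shows "discrete_rv T Y"
proof -
  have "integrable M (surprisal X) \<longleftrightarrow> integrable M (surprisal Y)"
    using surprisal_cong[of X Y] assms(4) by (intro Bochner_Integration.integrable_cong) auto
  then show ?thesis using assms by (simp add: discrete_rv_def)
qed

section \<open>Translation between the library entropies and \<open>shannon\<close>\<close>

text \<open>Change of variables along the law of \<open>X\<close>: weighting by the mass function on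
  \<open>S\<close> amounts to composing with \<open>X\<close> on \<open>M\<close>.\<close>

lemma discrete_rv_iff_finite_entropy:
  assumes "countable S" and X: "X \<in> measurable M (count_space S)"
  shows "discrete_rv S X \<longleftrightarrow> finite_entropy (count_space S) X (\<lambda>x. prob (X -` {x} \<inter> space M))"
proof -
  let ?p = "\<lambda>x. prob (X -` {x} \<inter> space M)"
  have d: "distributed M (count_space S) X ?p"
    using assms by (rule distributed_count_space)
  have "integrable (count_space S) (\<lambda>x. ?p x * log b (?p x)) \<longleftrightarrow> integrable M (\<lambda>\<omega>. log b (?p (X \<omega>)))"
    by (rule distributed_integrable[OF d]) auto
  also have "\<dots> \<longleftrightarrow> integrable M (surprisal X)"
    unfolding surprisal_def by simp
  finally show ?thesis
    using d assms by (simp add: discrete_rv_def finite_entropy_def)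
qed

lemma discrete_rv_finite_entropy:
  "discrete_rv S X \<Longrightarrow> finite_entropy (count_space S) X (\<lambda>x. prob (X -` {x} \<inter> space M))"
  using discrete_rv_iff_finite_entropy by (auto simp: discrete_rv_def)

lemma entropy_eq_shannon:
  assumes "discrete_rv S X"
  shows "entropy b (count_space S) X = shannon X"
proof -
  let ?p = "\<lambda>x. prob (X -` {x} \<inter> space M)"
  have d: "distributed M (count_space S) X ?p"
    using assms by (intro distributed_count_space) (auto simp: discrete_rv_def)
  have "entropy b (count_space S) X = - (\<integral>x. ?p x * log b (?p x) \<partial>count_space S)"
    by (rule entropy_distr[OF d]) auto
  also have "(\<integral>x. ?p x * log b (?p x) \<partial>count_space S) = (\<integral>\<omega>. log b (?p (X \<omega>)) \<partial>M)"
    by (rule distributed_integral[OF d]) auto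
  finally show ?thesis
    by (simp add: shannon_def surprisal_def)
qed

text \<open>The theorem assumes finiteness only for the individual entropies; this closure property,
  ultimately the bound H(X, Y) \<le> H(X) + H(Y), makes every joint entropy below finite.\<close>

lemma discrete_rv_Pair:
  assumes X: "discrete_rv S X" and Y: "discrete_rv T Y"
  shows "discrete_rv (S \<times> T) (\<lambda>\<omega>. (X \<omega>, Y \<omega>))"
proof -
  have S: "countable S" and T: "countable T"
    using X Y by (auto simp: discrete_rv_def)
  have "(\<lambda>\<omega>. (X \<omega>, Y \<omega>)) \<in> measurable M (count_space S \<Otimes>\<^sub>M count_space T)"
    using X Y by (intro measurable_Pair) (auto simp: discrete_rv_def)
  then have "(\<lambda>\<omega>. (X \<omega>, Y \<omega>)) \<in> measurable M (count_space (S \<times> T))"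
    by (simp add: pair_measure_countable S T)
  then show ?thesis
    using finite_entropy_Pair_count_space[OF S T discrete_rv_finite_entropy[OF X] discrete_rv_finite_entropy[OF Y]]
      S T by (simp add: discrete_rv_iff_finite_entropy)
qed

lemma mutual_information_eq_shannon:
  assumes X: "discrete_rv S X" and Y: "discrete_rv T Y"
  shows "mutual_information b (count_space S) (count_space T) X Y =
    shannon X + shannon Y - shannon (\<lambda>\<omega>. (X \<omega>, Y \<omega>))"
proof -
  have S: "countable S" and T: "countable T"
    using X Y by (auto simp: discrete_rv_def)
  note XY = discrete_rv_Pair[OF X Y]
  note fX = discrete_rv_finite_entropy[OF X] and fY = discrete_rv_finite_entropy[OF Y]
    and fXY = discrete_rv_finite_entropy[OF XY]
  note [simp] = pair_measure_countable[OF S T]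
  have sS: "sigma_finite_measure (count_space S)" and sT: "sigma_finite_measure (count_space T)"
    using S T by (auto intro: sigma_finite_measure_count_space_countable)
  note dXY = finite_entropy_distributed[OF fXY]
  let ?p = "\<lambda>z. prob ((\<lambda>\<omega>. (X \<omega>, Y \<omega>)) -` {z} \<inter> space M)"
  \<comment> \<open>The entropy formula for mutual information needs each marginal log-density to be
    integrable against the joint law. Each integral is that of a marginal entropy, pulled back along
    a projection.\<close>
  have "integrable (count_space (S \<times> T)) (\<lambda>z. ?p z * log b (prob (X -` {fst z} \<inter> space M)))"
    by (rule finite_entropy_integrable_transform[OF fX dXY]) auto
  moreover have "integrable (count_space (S \<times> T)) (\<lambda>z. ?p z * log b (prob (Y -` {snd z} \<inter> space M)))"
    by (rule finite_entropy_integrable_transform[OF fY dXY]) auto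
  ultimately have "mutual_information b (count_space S) (count_space T) X Y =
      entropy b (count_space S) X + entropy b (count_space T) Y
        - entropy b (count_space (S \<times> T)) (\<lambda>\<omega>. (X \<omega>, Y \<omega>))"
    using mutual_information_eq_entropy_conditional_entropy_distr
      [OF sS sT finite_entropy_distributed[OF fX] _ finite_entropy_distributed[OF fY], of ?p]
      dXY finite_entropy_integrable[OF fXY] by simp
  then show ?thesis
    by (simp add: entropy_eq_shannon[OF X] entropy_eq_shannon[OF Y] entropy_eq_shannon[OF XY])
qed

section \<open>Basic inequalities for joint entropies\<close>

text \<open>This is I(X; Y | Z) \<ge> 0, or equivalently H(X | Y, Z) \<le> H(X | Z). The library
  defines the conditional quantity as I(X; (Y, Z)) - I(X; Z), so H(X) cancels when both terms are
  expanded.\<close>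

lemma shannon_submodular:
  assumes X: "discrete_rv S X" and Y: "discrete_rv T Y" and Z: "discrete_rv U Z"
  shows "shannon (\<lambda>\<omega>. (X \<omega>, Y \<omega>, Z \<omega>)) + shannon Z
    \<le> shannon (\<lambda>\<omega>. (X \<omega>, Z \<omega>)) + shannon (\<lambda>\<omega>. (Y \<omega>, Z \<omega>))"
proof -
  have c: "countable S" "countable T" "countable U"
    using X Y Z by (auto simp: discrete_rv_def)
  have s: "sigma_finite_measure (count_space S)" "sigma_finite_measure (count_space T)"
    "sigma_finite_measure (count_space U)"
    using c by (auto intro: sigma_finite_measure_count_space_countable)
  note YZ = discrete_rv_Pair[OF Y Z] and XZ = discrete_rv_Pair[OF X Z]
  note XYZ = discrete_rv_Pair[OF X YZ]
  have [simp]: "count_space S \<Otimes>\<^sub>M count_space U = count_space (S \<times> U)"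
    "count_space T \<Otimes>\<^sub>M count_space U = count_space (T \<times> U)"
    "count_space S \<Otimes>\<^sub>M count_space (T \<times> U) = count_space (S \<times> T \<times> U)"
    using c by (auto intro!: pair_measure_countable)
  have "0 \<le> conditional_mutual_information b (count_space S) (count_space T) (count_space U) X Y Z"
    by (rule conditional_mutual_information_generic_nonneg'[OF s discrete_rv_finite_entropy[OF X]
        discrete_rv_finite_entropy[OF Z]])
      (use discrete_rv_finite_entropy[OF YZ] discrete_rv_finite_entropy[OF XZ]
        discrete_rv_finite_entropy[OF XYZ] in simp_all)
  then show ?thesis
    by (simp add: conditional_mutual_information_def mutual_information_eq_shannon[OF X YZ]
        mutual_information_eq_shannon[OF X Z])
qed

text \<open>The law of \<open>X\<close> has the point masses as its density, so the values of mass
  zero together form a null set.\<close>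

lemma AE_prob_vimage_pos:
  assumes "discrete_rv S X"
  shows "AE \<omega> in M. prob (X -` {X \<omega>} \<inter> space M) > 0"
proof -
  have S: "countable S" and X: "X \<in> measurable M (count_space S)"
    using assms by (auto simp: discrete_rv_def)
  have "AE x in distr M (count_space S) X. prob (X -` {x} \<inter> space M) > 0"
    unfolding distributed_distr_eq_density[OF distributed_count_space[OF S X]]
    by (subst AE_density) (auto simp: AE_count_space)
  then show ?thesis
    using X by (simp add: AE_distr_iff)
qed

text \<open>The pair induces a finer partition, so its fibres are smaller and its surprisal is
  larger almost everywhere.\<close>

lemma shannon_mono_Pair:
  assumes X: "discrete_rv S X" and Y: "discrete_rv T Y"
  shows "shannon X \<le> shannon (\<lambda>\<omega>. (X \<omega>, Y \<omega>))"
proof -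
  note XY = discrete_rv_Pair[OF X Y]
  \<comment> \<open>Null fibres must be excluded: \<open>log b 0\<close> is a real number rather
    than minus infinity, so the pointwise comparison can fail there.\<close>
  have "AE \<omega> in M. prob ((\<lambda>\<omega>. (X \<omega>, Y \<omega>)) -` {(X \<omega>, Y \<omega>)} \<inter> space M) > 0"
    using AE_prob_vimage_pos[OF XY] by simp
  then have "AE \<omega> in M. surprisal X \<omega> \<le> surprisal (\<lambda>\<omega>. (X \<omega>, Y \<omega>)) \<omega>"
  proof (rule AE_mp, intro AE_I2 impI)
    fix \<omega>
    let ?A = "(\<lambda>\<omega>. (X \<omega>, Y \<omega>)) -` {(X \<omega>, Y \<omega>)} \<inter> space M"
    assume \<omega>: "\<omega> \<in> space M" and pos: "prob ?A > 0"
    have "X -` {X \<omega>} \<inter> space M \<in> events"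
      using X \<omega> by (intro measurable_sets[of X M "count_space S"])
        (auto simp: discrete_rv_def dest: measurable_space)
    then have "prob ?A \<le> prob (X -` {X \<omega>} \<inter> space M)"
      by (intro finite_measure_mono) auto
    then show "surprisal X \<omega> \<le> surprisal (\<lambda>\<omega>. (X \<omega>, Y \<omega>)) \<omega>"
      using pos b_gt_1 by (simp add: surprisal_def)
  qed
  then show ?thesis
    using X XY unfolding shannon_def discrete_rv_def by (intro integral_mono_AE) auto
qed

lemma surprisal_const: "surprisal (\<lambda>_. c) = (\<lambda>_. 0)"
  by (simp add: surprisal_def fun_eq_iff prob_space)

section \<open>Chain rules for finite tuples\<close>

lemma discrete_rv_restrict:
  assumes "finite J" and "\<And>i. i \<in> J \<Longrightarrow> discrete_rv (S i) (X i)"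
  shows "discrete_rv (PiE J S) (\<lambda>\<omega>. \<lambda>i\<in>J. X i \<omega>)"
  using assms
proof (induction J)
  case empty
  then show ?case by (simp add: discrete_rv_def surprisal_const)
next
  case (insert j J)
  have P: "discrete_rv (S j \<times> PiE J S) (\<lambda>\<omega>. (X j \<omega>, \<lambda>i\<in>J. X i \<omega>))"
    by (intro discrete_rv_Pair insert.IH insert.prems) simp_all
  then show ?case
  proof (rule discrete_rv_cong)
    show "countable (PiE (insert j J) S)"
      using insert by (intro countable_PiE) (auto simp: discrete_rv_def)
    \<comment> \<open>Function update re-encodes the pair as a longer tuple. Any map between the two
      value sets is measurable, since both carry counting measures.\<close>
    have m: "(\<lambda>(a, f). f(j := a)) \<in> measurable (count_space (S j \<times> PiE J S)) (count_space (PiE (insert j J) S))"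
      by (auto simp: PiE_insert_eq)
    have "(\<lambda>\<omega>. (\<lambda>(a, f). f(j := a)) (X j \<omega>, \<lambda>i\<in>J. X i \<omega>))
        \<in> measurable M (count_space (PiE (insert j J) S))"
      by (rule measurable_compose[OF _ m]) (use P in \<open>simp only: discrete_rv_def\<close>)
    also have "(\<lambda>\<omega>. (\<lambda>(a, f). f(j := a)) (X j \<omega>, \<lambda>i\<in>J. X i \<omega>)) = (\<lambda>\<omega>. \<lambda>i\<in>insert j J. X i \<omega>)"
      by (auto simp: fun_eq_iff)
    finally show "(\<lambda>\<omega>. \<lambda>i\<in>insert j J. X i \<omega>) \<in> measurable M (count_space (PiE (insert j J) S))" .
  next
    fix \<omega> \<omega>'
    show "(X j \<omega>, \<lambda>i\<in>J. X i \<omega>) = (X j \<omega>', \<lambda>i\<in>J. X i \<omega>') \<longleftrightarrow>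
      (\<lambda>i\<in>insert j J. X i \<omega>) = (\<lambda>i\<in>insert j J. X i \<omega>')"
      using insert by (auto simp: fun_eq_iff restrict_def)
  qed
qed

text \<open>The summand is H(X_i | X_{I-{i}}). Keeping \<open>I\<close> fixed while \<open>J\<close>
  grows makes induction possible: adding \<open>j\<close> raises the joint entropy by H(X_j | X_J),
  and J \<subseteq> I - {j} gives H(X_j | X_{I-{j}}) \<le> H(X_j | X_J).\<close>

lemma sum_conditional_shannon_le:
  assumes I: "finite I" and X: "\<And>i. i \<in> I \<Longrightarrow> discrete_rv (S i) (X i)" and "J \<subseteq> I"
  shows "(\<Sum>i\<in>J. shannon (\<lambda>\<omega>. \<lambda>k\<in>I. X k \<omega>) - shannon (\<lambda>\<omega>. \<lambda>k\<in>I - {i}. X k \<omega>))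
    \<le> shannon (\<lambda>\<omega>. \<lambda>k\<in>J. X k \<omega>)"
proof -
  have "finite J" using I \<open>J \<subseteq> I\<close> by (rule rev_finite_subset)
  then show ?thesis
    using \<open>J \<subseteq> I\<close>
  proof (induction J)
    case empty
    then show ?case by (simp add: shannon_def surprisal_const)
  next
    case (insert j J)
    have j: "j \<in> I" "j \<notin> J" "J \<subseteq> I" using insert by auto
    have rv: "discrete_rv (PiE K S) (\<lambda>\<omega>. \<lambda>k\<in>K. X k \<omega>)" if "K \<subseteq> I" for K
      using that I X by (intro discrete_rv_restrict) (auto intro: finite_subset)
    \<comment> \<open>Submodularity is applied to overlapping tuples. The copy of X_J is determined
      by X_{I-{j}}, so the following equalities can drop it.\<close>
    have "shannon (\<lambda>\<omega>. (X j \<omega>, \<lambda>k\<in>I - {j}. X k \<omega>, \<lambda>k\<in>J. X k \<omega>)) + shannon (\<lambda>\<omega>. \<lambda>k\<in>J. X k \<omega>)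
      \<le> shannon (\<lambda>\<omega>. (X j \<omega>, \<lambda>k\<in>J. X k \<omega>)) + shannon (\<lambda>\<omega>. (\<lambda>k\<in>I - {j}. X k \<omega>, \<lambda>k\<in>J. X k \<omega>))"
      using j by (intro shannon_submodular[OF X rv rv]) auto
    also have "shannon (\<lambda>\<omega>. (X j \<omega>, \<lambda>k\<in>I - {j}. X k \<omega>, \<lambda>k\<in>J. X k \<omega>)) = shannon (\<lambda>\<omega>. \<lambda>k\<in>I. X k \<omega>)"
      using j by (intro shannon_cong) (auto simp: fun_eq_iff restrict_def)
    also have "shannon (\<lambda>\<omega>. (X j \<omega>, \<lambda>k\<in>J. X k \<omega>)) = shannon (\<lambda>\<omega>. \<lambda>k\<in>insert j J. X k \<omega>)"
      using j by (intro shannon_cong) (auto simp: fun_eq_iff restrict_def)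
    also have "shannon (\<lambda>\<omega>. (\<lambda>k\<in>I - {j}. X k \<omega>, \<lambda>k\<in>J. X k \<omega>)) = shannon (\<lambda>\<omega>. \<lambda>k\<in>I - {j}. X k \<omega>)"
      using j by (intro shannon_cong) (auto simp: fun_eq_iff restrict_def)
    finally show ?case
      using insert.IH[OF j(3)] insert.hyps by (simp del: restrict_apply)
  qed
qed

text \<open>Subadditivity of entropy conditional on \<open>Y\<close>: adding \<open>j\<close>
  contributes H(X_j | X_J, Y) \<le> H(X_j | Y), which is submodularity with \<open>Y\<close> in the
  conditioning slot.\<close>

lemma shannon_Pair_le_sum:
  assumes "finite J" and "\<And>i. i \<in> J \<Longrightarrow> discrete_rv (S i) (X i)" and Y: "discrete_rv T Y"
  shows "shannon (\<lambda>\<omega>. (\<lambda>k\<in>J. X k \<omega>, Y \<omega>))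
    \<le> shannon Y + (\<Sum>i\<in>J. shannon (\<lambda>\<omega>. (X i \<omega>, Y \<omega>)) - shannon Y)"
  using assms(1,2)
proof (induction J)
  case empty
  have "shannon (\<lambda>\<omega>. (\<lambda>k\<in>{}. X k \<omega>, Y \<omega>)) = shannon Y"
    by (intro shannon_cong) auto
  then show ?case by (simp del: restrict_apply)
next
  case (insert j J)
  have "shannon (\<lambda>\<omega>. (X j \<omega>, \<lambda>k\<in>J. X k \<omega>, Y \<omega>)) + shannon Y
    \<le> shannon (\<lambda>\<omega>. (X j \<omega>, Y \<omega>)) + shannon (\<lambda>\<omega>. (\<lambda>k\<in>J. X k \<omega>, Y \<omega>))"
    using insert.prems
    by (intro shannon_submodular[OF _ discrete_rv_restrict[OF insert.hyps(1)] Y]) auto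
  also have "shannon (\<lambda>\<omega>. (X j \<omega>, \<lambda>k\<in>J. X k \<omega>, Y \<omega>)) = shannon (\<lambda>\<omega>. (\<lambda>k\<in>insert j J. X k \<omega>, Y \<omega>))"
    using insert.hyps by (intro shannon_cong) (auto simp: fun_eq_iff restrict_def)
  finally show ?case
    using insert.IH insert.prems insert.hyps by (simp del: restrict_apply)
qed

section \<open>Assembly of the inequality\<close>

lemma sum_mutual_information_le:
  assumes I: "finite I" and X: "\<And>i. i \<in> I \<Longrightarrow> discrete_rv (S i) (X i)" and Y: "discrete_rv T Y"
  shows "(\<Sum>i\<in>I. mutual_information b (count_space (S i)) (count_space T) (X i) Y)
    \<le> entropy b (count_space T) Y
      + (\<Sum>i\<in>I. mutual_information b (count_space (S i)) (count_space (PiE (I - {i}) S))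
          (X i) (\<lambda>\<omega>. \<lambda>j\<in>I - {i}. X j \<omega>))"
proof -
  let ?X = "\<lambda>J \<omega>. \<lambda>j\<in>J. X j \<omega>"
  \<comment> \<open>Here and in \<open>r\<close>, each mutual information is split as H(X_i) minus a
    conditional entropy, so that the sum of the H(X_i) cancels between the two sides.\<close>
  have l: "mutual_information b (count_space (S i)) (count_space T) (X i) Y
      = shannon (X i) - (shannon (\<lambda>\<omega>. (X i \<omega>, Y \<omega>)) - shannon Y)" if "i \<in> I" for i
    using mutual_information_eq_shannon[OF X[OF that] Y] by simp
  have r: "mutual_information b (count_space (S i)) (count_space (PiE (I - {i}) S)) (X i) (?X (I - {i}))
      = shannon (X i) - (shannon (?X I) - shannon (?X (I - {i})))" if "i \<in> I" for i
  proof -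
    have rv: "discrete_rv (PiE (I - {i}) S) (?X (I - {i}))"
      using I X by (intro discrete_rv_restrict) auto
    have "shannon (\<lambda>\<omega>. (X i \<omega>, ?X (I - {i}) \<omega>)) = shannon (?X I)"
      using that by (intro shannon_cong) (auto simp: fun_eq_iff restrict_def)
    then show ?thesis
      using mutual_information_eq_shannon[OF X[OF that] rv] by simp
  qed
  have "(\<Sum>i\<in>I. shannon (?X I) - shannon (?X (I - {i}))) \<le> shannon (?X I)"
    using I X by (rule sum_conditional_shannon_le) auto
  also have "\<dots> \<le> shannon (\<lambda>\<omega>. (?X I \<omega>, Y \<omega>))"
    using I X by (rule shannon_mono_Pair[OF discrete_rv_restrict Y])
  also have "\<dots> \<le> shannon Y + (\<Sum>i\<in>I. shannon (\<lambda>\<omega>. (X i \<omega>, Y \<omega>)) - shannon Y)"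
    using I X Y by (rule shannon_Pair_le_sum)
  finally show ?thesis
    using l r by (simp add: entropy_eq_shannon[OF Y] sum_subtractf cong: sum.cong)
qed

end

theorem theorem6:
  fixes M :: "'w measure" and b :: real and p :: nat
    and S :: "nat \<Rightarrow> 'a set" and X :: "nat \<Rightarrow> 'w \<Rightarrow> 'a"
    and T :: "'b set" and y :: "'w \<Rightarrow> 'b"
  assumes "information_space M b"
    and "\<And>i. i \<in> {1..p} \<Longrightarrow> countable (S i)"
    and "\<And>i. i \<in> {1..p} \<Longrightarrow> X i \<in> measurable M (count_space (S i))"
    and "countable T"
    and "y \<in> measurable M (count_space T)"
    and "\<And>i. i \<in> {1..p} \<Longrightarrow>
      information_space.finite_entropy M b (count_space (S i)) (X i)
        (\<lambda>a. measure M (X i -` {a} \<inter> space M))"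
    and "information_space.finite_entropy M b (count_space T) y
        (\<lambda>c. measure M (y -` {c} \<inter> space M))"
  shows "(\<Sum>i = 1..p. prob_space.mutual_information M b
            (count_space (S i)) (count_space T) (X i) y)
      \<le> prob_space.entropy M b (count_space T) y
        + (\<Sum>i = 1..p. prob_space.mutual_information M b
            (count_space (S i)) (count_space (PiE ({1..p} - {i}) S))
            (X i) (\<lambda>\<omega>. \<lambda>j\<in>{1..p} - {i}. X j \<omega>))"
proof -
  interpret information_space M b by fact
  show ?thesis
    using assms(2-7) by (intro sum_mutual_information_le) (auto simp: discrete_rv_iff_finite_entropy)
qed

end
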